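(* Let $A,B,C\in M_2(\mathbb R)$ be such that the system $Af_{xx}+2Bf_{xy}+Cf_{yy}=0$ for $f=(u,v)^t$ is elliptic and non-reducible, and let $\tau,\sigma$ be its canonical parameters. Then the following are equivalent. (i) The system is (up to replacing its equations by non-degenerate real linear combinations of them, i.e. up to replacing $(A,B,C)$ by $(PA,PB,PC)$ with some $P\in M_2(\mathbb R)$, $\det P\ne 0$) the system of Euler--Lagrange equations for some functional of the form $$\mathcal E f=\frac12\int_D (E\nabla f,\nabla f)\,dm_2,$$ where $E\in M_4(\mathbb R)$ is a symmetric non-negative definite matrix. (ii) The system is strongly elliptic and $\sigma>\tau$.
   Context: $M_k(\mathbb R)$ is the space of real $k\times k$ matrices. A function $f=u+iv$ on a plane domain, with $u,v$ real-valued, is identified with the vector $(u,v)^t$; $f_{xx}=(u_{xx},v_{xx})^t$, and similarly for $f_{xy}$, $f_{yy}$. Ellipticity. The system $Af_{xx}+2Bf_{xy}+Cf_{yy}=0$ is elliptic if $\det(A\xi^2+2B\xi\eta+C\eta^2)$, for real $\xi,\eta$, vanishes only at $\xi=\eta=0$. Admissible transformations and equivalence. Admissible transformations of a system are: (1) non-degenerate real linear changes of variables $\zeta=Tz$, $z=(x,y)^t$, which replace $(A,B,C)$ by $$(t_{11}^2A+2t_{11}t_{12}B+t_{12}^2C,\ \ t_{11}t_{21}A+(t_{11}t_{22}+t_{12}t_{21})B+t_{21}t_{22}C,\ \ t_{21}^2A+2t_{21}t_{22}B+t_{22}^2C),$$ where $T=(t_{jk})\in M_2(\mathbb R)$, $\det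 T\neq0$; (2) non-degenerate real linear changes of the unknown functions, which replace $(A,B,C)$ by $(AQ,BQ,CQ)$ with $Q\in M_2(\mathbb R)$, $\det Q\ne0$; (3) non-degenerate real linear combinations of the equations, which replace $(A,B,C)$ by $(PA,PB,PC)$ with $P\in M_2(\mathbb R)$, $\det P\neq 0$. One system can be reduced to another if it is carried to it by a composition of such transformations. Reducibility. A system is reducible if it can be reduced by admissible transformations to a system in which $A,B,C$ are all upper triangular; otherwise it is non-reducible. Strong ellipticity. An elliptic system is strongly elliptic if $\det(\alpha A+2\beta B+\gamma C)\ne0$ for all real $\alpha,\beta,\gamma$ with $\beta^2-\alpha\gamma<0$. (Modulo equivalence of systems under admissible transformations this coincides with Vishik's condition that the symmetric part of $A\xi^2+2B\xi\eta+C\eta^2$ be positive definite for all real $(\xi,\eta)\neq(0,0)$.) Canonical parameters. Every non-reducible elliptic system can be reduced by admissible transformations to the system with matrices $$\begin{pmatrix}1&0\\0&1\end{pmatrix},\qquad \begin{pmatrix}0&1\\-\frac14(1-\lambda)(1-\kappa^2/\lambda)&0\end{pmatrix},\qquad \begin{pmatrix}\lambda&0\\0&\kappa^2/\lambda\end{pmatrix}$$ (in the roles of $A,B,C$), where $\kappa\in(0,1]$ and $\lambda\in[-\kappa,\kappa]\setminus\{0,\kappa^2\}$; strong ellipticity of the system is equivalent to $\lambda>0$. The canonical parameters $\tau,\sigma$ of the system are $$\tau=\frac{1-\kappa}{1+\kappa},\qquad \sigma=\frac{\kappa-\lambda}{\kappa+\lambda}$$ (with $\sigma=\infty$ if $\lambda=-\kappa$).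 In the strongly elliptic case $0\le\tau<1$ and $0\le\sigma<1$. Functional. $\nabla f=(u_x,v_x,u_y,v_y)^t$, $(\cdot,\cdot)$ is the Euclidean scalar product, $m_2$ is the two-dimensional Lebesgue measure. $D$ is a Jordan domain in the plane with boundary $\varGamma$, and the functional is considered on functions $f\in C^2(D)\cap C^1(\overline D)$ with prescribed boundary values $f|_\varGamma=h$, $h\in C(\varGamma)$. Its Euler--Lagrange system is the usual one: with $\varPhi(u_x,v_x,u_y,v_y)=\frac12(E\nabla f,\nabla f)$, it is $\partial_x\varPhi_{u_x}+\partial_y\varPhi_{u_y}=0$, $\partial_x\varPhi_{v_x}+\partial_y\varPhi_{v_y}=0$; it depends only on $E$, not on $D$ or $h$.
   Formalization: In the effect of a linear change of variables on B, the last term is taken as t₁₂t₂₂C, the actual result of ζ=Tz, instead of the misprinted t₂₁t₂₂C given among the admissible transformations. *)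

theory Defs
  imports "HOL-Analysis.Analysis"
begin

text \<open>
  A triple \<open>(A, B, C)\<close> stands for the system \<open>A f_xx + 2 B f_xy + C f_yy = 0\<close>
  (note the factor 2).  The plane is \<^typ>\<open>complex\<close>, and \<open>f = (u, v)\<^sup>t\<close> takes values
  in \<open>real^2\<close>.  Matrices are written by rows.
\<close>

type_synonym system = "(real^2^2) \<times> (real^2^2) \<times> (real^2^2)"

fun elliptic :: "system \<Rightarrow> bool" where
  "elliptic (A, B, C) \<longleftrightarrow>
     (\<forall>\<xi> \<eta> :: real. det (\<xi>\<^sup>2 *\<^sub>R A + (2 * \<xi> * \<eta>) *\<^sub>R B + \<eta>\<^sup>2 *\<^sub>R C) = 0 \<longrightarrow> \<xi> = 0 \<and> \<eta> = 0)"

fun strongly_elliptic :: "system \<Rightarrow> bool" where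
  "strongly_elliptic (A, B, C) \<longleftrightarrow>
     elliptic (A, B, C) \<and>
     (\<forall>\<alpha> \<beta> \<gamma> :: real. \<beta>\<^sup>2 - \<alpha> * \<gamma> < 0 \<longrightarrow> det (\<alpha> *\<^sub>R A + (2 * \<beta>) *\<^sub>R B + \<gamma> *\<^sub>R C) \<noteq> 0)"

inductive admissible_step :: "system \<Rightarrow> system \<Rightarrow> bool" where
  change_variables:
    "det (T :: real^2^2) \<noteq> 0 \<Longrightarrow> admissible_step (A, B, C)
       ((T$1$1)\<^sup>2 *\<^sub>R A + (2 * T$1$1 * T$1$2) *\<^sub>R B + (T$1$2)\<^sup>2 *\<^sub>R C,
        (T$1$1 * T$2$1) *\<^sub>R A + (T$1$1 * T$2$2 + T$1$2 * T$2$1) *\<^sub>R B + (T$1$2 * T$2$2) *\<^sub>R C,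
        (T$2$1)\<^sup>2 *\<^sub>R A + (2 * T$2$1 * T$2$2) *\<^sub>R B + (T$2$2)\<^sup>2 *\<^sub>R C)"
| change_unknowns:
    "det (Q :: real^2^2) \<noteq> 0 \<Longrightarrow> admissible_step (A, B, C) (A ** Q, B ** Q, C ** Q)"
| combine_equations:
    "det (P :: real^2^2) \<noteq> 0 \<Longrightarrow> admissible_step (A, B, C) (P ** A, P ** B, P ** C)"

definition reduces_to :: "system \<Rightarrow> system \<Rightarrow> bool" where
  "reduces_to = admissible_step\<^sup>*\<^sup>*"

text \<open>
  In the index type \<open>2\<close> one has \<open>2 = 0 < 1\<close>, so triangularity is not expressed through
  the order on indices.
\<close>

definition upper_triangular2 :: "real^2^2 \<Rightarrow> bool" where
  "upper_triangular2 M \<longleftrightarrow> M$2$1 = 0"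

definition reducible :: "system \<Rightarrow> bool" where
  "reducible S \<longleftrightarrow>
     (\<exists>A B C. reduces_to S (A, B, C) \<and>
        upper_triangular2 A \<and> upper_triangular2 B \<and> upper_triangular2 C)"

definition canonical_system :: "real \<Rightarrow> real \<Rightarrow> system" where
  "canonical_system \<kappa> lam =
     (vector [vector [1, 0],
              vector [0, 1]],
      vector [vector [0, 1],
              vector [- (1/4) * (1 - lam) * (1 - \<kappa>\<^sup>2 / lam), 0]],
      vector [vector [lam, 0],
              vector [0, \<kappa>\<^sup>2 / lam]])"

text \<open>The parameter \<open>\<sigma>\<close> is extended real, since \<open>\<sigma> = \<infinity>\<close> when \<open>lam = -\<kappa>\<close>.\<close>

definition canonical_parameters :: "system \<Rightarrow> real \<Rightarrow> ereal \<Rightarrow> bool" where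
  "canonical_parameters S \<tau> \<sigma> \<longleftrightarrow>
     (\<exists>\<kappa> lam. \<kappa> \<in> {0<..1} \<and> lam \<in> {-\<kappa>..\<kappa>} - {0, \<kappa>\<^sup>2} \<and>
        reduces_to S (canonical_system \<kappa> lam) \<and>
        \<tau> = (1 - \<kappa>) / (1 + \<kappa>) \<and>
        \<sigma> = (if lam = -\<kappa> then \<infinity> else ereal ((\<kappa> - lam) / (\<kappa> + lam))))"

definition jordan_domain :: "complex set \<Rightarrow> bool" where
  "jordan_domain D \<longleftrightarrow>
     (\<exists>g :: real \<Rightarrow> complex. simple_path g \<and> pathfinish g = pathstart g \<and>
        D = inside (path_image g))"

definition C2_on :: "complex set \<Rightarrow> (complex \<Rightarrow> real^2) \<Rightarrow> bool" where
  "C2_on D f \<longleftrightarrow>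
     (\<exists>(f' :: complex \<Rightarrow> (complex \<Rightarrow>\<^sub>L (real^2)))
       (f'' :: complex \<Rightarrow> (complex \<Rightarrow>\<^sub>L (complex \<Rightarrow>\<^sub>L (real^2)))).
        (\<forall>z\<in>D. (f has_derivative blinfun_apply (f' z)) (at z)) \<and>
        (\<forall>z\<in>D. (f' has_derivative blinfun_apply (f'' z)) (at z)) \<and>
        continuous_on D f'')"

definition partial_deriv ::
    "'a::real_vector \<Rightarrow> ('a \<Rightarrow> 'b::real_normed_vector) \<Rightarrow> 'a \<Rightarrow> 'b" where
  "partial_deriv v g z = vector_derivative (\<lambda>t. g (z + t *\<^sub>R v)) (at 0)"

abbreviation dx :: "(complex \<Rightarrow> 'b::real_normed_vector) \<Rightarrow> complex \<Rightarrow> 'b" where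
  "dx \<equiv> partial_deriv 1"

abbreviation dy :: "(complex \<Rightarrow> 'b::real_normed_vector) \<Rightarrow> complex \<Rightarrow> 'b" where
  "dy \<equiv> partial_deriv \<i>"

text \<open>Left-hand side of the system with the given matrices.\<close>

fun system_operator :: "system \<Rightarrow> (complex \<Rightarrow> real^2) \<Rightarrow> complex \<Rightarrow> real^2" where
  "system_operator (A, B, C) f z =
     A *v dx (dx f) z + 2 *\<^sub>R (B *v dy (dx f) z) + C *v dy (dy f) z"

text \<open>The gradient is ordered as \<open>(u_x, v_x, u_y, v_y)\<^sup>t\<close>.\<close>

definition grad :: "(complex \<Rightarrow> real^2) \<Rightarrow> complex \<Rightarrow> real^4" where
  "grad f z = vector [dx f z $ 1, dx f z $ 2, dy f z $ 1, dy f z $ 2]"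

text \<open>
  Left-hand side of the Euler--Lagrange system of the functional with integrand
  \<open>\<Phi> (grad f)\<close>: the equations
  \<open>\<partial>_x \<Phi>_(u_x) + \<partial>_y \<Phi>_(u_y) = 0\<close> and \<open>\<partial>_x \<Phi>_(v_x) + \<partial>_y \<Phi>_(v_y) = 0\<close>.
\<close>

definition euler_lagrange ::
    "(real^4 \<Rightarrow> real) \<Rightarrow> (complex \<Rightarrow> real^2) \<Rightarrow> complex \<Rightarrow> real^2" where
  "euler_lagrange \<Phi> f z =
     (let \<Phi>' = (\<lambda>k w. partial_deriv (axis k 1) \<Phi> (grad f w))
      in vector [dx (\<Phi>' 1) z + dy (\<Phi>' 3) z,
                 dx (\<Phi>' 2) z + dy (\<Phi>' 4) z])"

text \<open>Integrand of the functional \<open>\<E> f = 1/2 \<integral>_D (E \<nabla>f, \<nabla>f)\<close>.\<close>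

definition energy_density :: "real^4^4 \<Rightarrow> real^4 \<Rightarrow> real" where
  "energy_density E p = 1/2 * ((E *v p) \<bullet> p)"

definition nonneg_definite :: "real^4^4 \<Rightarrow> bool" where
  "nonneg_definite E \<longleftrightarrow> (\<forall>p. 0 \<le> (E *v p) \<bullet> p)"

text \<open>
  Two systems are the same when their left-hand sides agree for all twice continuously
  differentiable \<open>f\<close>, at all points of the domain of the functional.
\<close>

definition is_euler_lagrange_system :: "complex set \<Rightarrow> real^4^4 \<Rightarrow> system \<Rightarrow> bool" where
  "is_euler_lagrange_system D E S \<longleftrightarrow>
     (\<forall>f. C2_on D f \<longrightarrow>
        (\<forall>z\<in>D. system_operator S f z = euler_lagrange (energy_density E) f z))"

end

theory Submission
  imports Defs
begin

text \<open>
  A functional with symmetric energy matrix \<open>E\<close>, split into \<open>2 \<times> 2\<close> blocks, has the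
  Euler--Lagrange system with matrices \<open>E\<^sub>1\<^sub>1\<close>, \<open>(E\<^sub>1\<^sub>2 + E\<^sub>2\<^sub>1) / 2\<close>, \<open>E\<^sub>2\<^sub>2\<close>.  Hence a system is
  variational with nonnegative energy iff, for some invertible \<open>P\<close>, the matrices \<open>P A\<close>,
  \<open>P B\<close>, \<open>P C\<close> are symmetric and some real \<open>s\<close> makes
  \<open>(P A, P B + s J; P B - s J, P C)\<close> nonnegative definite, where \<open>J\<close> is the standard
  antisymmetric matrix (\<open>ex_energy_iff_variational\<close>).  The symmetry of second derivatives
  removes \<open>s\<close> from the equations, and quadratic test functions show that the equations, as
  differential operators, determine their matrices.

  This condition is invariant under admissible transformations, because linear substitutions
  carry a nonnegative energy to a nonnegative energy (\<open>variational_step\<close>), and so is the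
  condition that distinguishes strong ellipticity from ellipticity
  (\<open>definite_regular_step\<close>).  It is therefore enough to look at the canonical system.  There,
  symmetry determines \<open>P\<close> closely enough to force \<open>0 < lam < \<kappa>\<^sup>2\<close>
  (\<open>variational_canonical_imp\<close>); conversely, for such \<open>lam\<close> the energy splits into two binary
  forms, and a suitable \<open>s\<close> makes both nonnegative (\<open>variational_canonical\<close>).  Finally
  \<open>lam > 0\<close> is strong ellipticity (\<open>definite_regular_canonical\<close>), and for positive \<open>lam\<close> the
  inequality \<open>lam < \<kappa>\<^sup>2\<close> is the inequality \<open>\<sigma> > \<tau>\<close> between the canonical parameters
  (\<open>sigma_gt_tau_iff\<close>).
\<close>

section \<open>Symmetry of the second derivative\<close>

text \<open>
  For \<open>\<phi> s = f (z + s t u + t v) - f (z + s t u)\<close> the second difference below is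
  \<open>\<phi> 1 - \<phi> 0\<close>, and \<open>\<phi>' s\<close> is \<open>t\<close> times the increment of \<open>f'\<close> in the direction \<open>t v\<close>,
  applied to \<open>u\<close>; by differentiability of \<open>f'\<close> at \<open>z\<close> this is \<open>t\<^sup>2 f'' v u + o(t\<^sup>2)\<close>
  uniformly in \<open>s\<close>.  The mean value inequality turns this into a bound on \<open>\<phi> 1 - \<phi> 0\<close>.
\<close>

lemma second_difference_bound:
  fixes f :: "'a::real_normed_vector \<Rightarrow> 'b::real_normed_vector"
    and f' :: "'a \<Rightarrow> 'a \<Rightarrow>\<^sub>L 'b" and f'' :: "'a \<Rightarrow>\<^sub>L 'a \<Rightarrow>\<^sub>L 'b"
  assumes "open D" "z \<in> D"
    and f': "\<And>w. w \<in> D \<Longrightarrow> (f has_derivative blinfun_apply (f' w)) (at w)"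
    and f'': "(f' has_derivative blinfun_apply f'') (at z)"
    and "e > 0"
  obtains d where "d > 0"
    "\<And>t. 0 < t \<Longrightarrow> t < d \<Longrightarrow>
       norm (f (z + t *\<^sub>R u + t *\<^sub>R v) - f (z + t *\<^sub>R u) - f (z + t *\<^sub>R v) + f z
             - t\<^sup>2 *\<^sub>R f'' v u) \<le> e * t\<^sup>2"
proof -
  define M where "M = norm u + norm v + 1"
  have M: "M > 0" "norm u \<le> M"
    by (auto simp: M_def add_nonneg_pos)
  define e' where "e' = e / (2 * M\<^sup>2)"
  have e': "e' > 0" using \<open>e > 0\<close> M by (simp add: e'_def)
  obtain r where r: "r > 0" "ball z r \<subseteq> D"
    using \<open>open D\<close> \<open>z \<in> D\<close> openE by blast
  obtain d0 where d0: "d0 > 0"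
    and lin: "\<And>y. norm (y - z) < d0 \<Longrightarrow> norm (f' y - f' z - f'' (y - z)) \<le> e' * norm (y - z)"
    using f'' e' unfolding has_derivative_at_alt by blast
  define d where "d = min r d0 / M"
  show thesis
  proof
    show "d > 0" using r d0 M by (simp add: d_def)
    fix t :: real assume t: "0 < t" "t < d"
    then have tM: "t * M < r" "t * M < d0"
      using M by (auto simp: d_def field_simps)
    have near: "norm ((s * t) *\<^sub>R u + c *\<^sub>R v) \<le> t * M" if "s \<in> {0..1}" "c \<in> {0, t}" for s c
    proof -
      have "norm ((s * t) *\<^sub>R u + c *\<^sub>R v) \<le> s * t * norm u + c * norm v"
        using that t by (intro order_trans[OF norm_triangle_ineq]) auto
      also have "\<dots> \<le> t * norm u + t * norm v"
        using that t by (intro add_mono mult_right_mono) (auto simp: mult_left_le_one_le)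
      also have "\<dots> \<le> t * M" using t by (simp add: M_def distrib_left)
      finally show ?thesis .
    qed
    define p where "p s c = z + ((s * t) *\<^sub>R u + c *\<^sub>R v)" for s c
    \<comment> \<open>\<open>\<psi>\<close> is \<open>\<phi>\<close> minus its expected linear part, so its derivative is small on the
          whole interval and \<open>\<psi> 1 - \<psi> 0\<close> is the error to be bounded.\<close>
    define \<psi> where "\<psi> s = f (p s t) - f (p s 0) - (s * t\<^sup>2) *\<^sub>R f'' v u" for s
    define \<psi>' where "\<psi>' s h = (h * t) *\<^sub>R (f' (p s t) u - f' (p s 0) u - t *\<^sub>R f'' v u)" for s h :: real
    have pD: "p s c \<in> D" if "s \<in> {0..1}" "c \<in> {0, t}" for s c
    proof -
      have "dist (p s c) z < r"
        using near[OF that] tM by (simp add: p_def dist_norm)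
      then show ?thesis using r by (auto simp: dist_commute)
    qed
    have dp: "((\<lambda>s. f (p s c)) has_derivative (\<lambda>h. f' (p s c) ((h * t) *\<^sub>R u))) (at s within {0..1})"
      if "s \<in> {0..1}" "c \<in> {0, t}" for s c
    proof -
      have "((\<lambda>s. p s c) has_derivative (\<lambda>h. (h * t) *\<^sub>R u)) (at s within {0..1})"
        unfolding p_def by (auto intro!: derivative_eq_intros)
      from has_derivative_compose[OF this f'[OF pD[OF that]]] show ?thesis .
    qed
    have d\<psi>: "(\<psi> has_derivative \<psi>' s) (at s within {0..1})" if "s \<in> {0..1}" for s
    proof -
      have "(\<psi> has_derivative (\<lambda>h. f' (p s t) ((h * t) *\<^sub>R u) - f' (p s 0) ((h * t) *\<^sub>R u)
              - (h * t\<^sup>2) *\<^sub>R f'' v u)) (at s within {0..1})"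
        unfolding \<psi>_def using that by (auto intro!: derivative_eq_intros dp)
      moreover have "(\<lambda>h. f' (p s t) ((h * t) *\<^sub>R u) - f' (p s 0) ((h * t) *\<^sub>R u)
              - (h * t\<^sup>2) *\<^sub>R f'' v u) = \<psi>' s"
        by (auto simp: \<psi>'_def blinfun.bilinear_simps algebra_simps power2_eq_square)
      ultimately show ?thesis by simp
    qed
    have bound: "onorm (\<psi>' s) \<le> e * t\<^sup>2" if s: "s \<in> {0..1}" for s
    proof (rule onorm_le)
      fix h
      \<comment> \<open>Both increments of \<open>f'\<close> are compared with its linearization at \<open>z\<close>; each
              remainder costs half of \<open>e\<close>.\<close>
      define R where "R c = f' (p s c) - f' z - f'' (p s c - z)" for c
      have R: "norm (R c u) \<le> e' * (t * M) * M" if c: "c \<in> {0, t}" for c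
      proof -
        have "norm (R c) \<le> e' * norm (p s c - z)"
          unfolding R_def using near[OF s c] tM by (intro lin) (simp add: p_def)
        also have "\<dots> \<le> e' * (t * M)"
          using near[OF s c] e' by (simp add: p_def)
        finally have "norm (R c) \<le> e' * (t * M)" .
        then show ?thesis
          using M e' t by (intro order_trans[OF norm_blinfun] mult_mono) auto
      qed
      have "f' (p s t) u - f' (p s 0) u - t *\<^sub>R f'' v u = R t u - R 0 u"
        by (simp add: R_def p_def blinfun.bilinear_simps algebra_simps)
      then have "norm (f' (p s t) u - f' (p s 0) u - t *\<^sub>R f'' v u) \<le> norm (R t u) + norm (R 0 u)"
        by (simp add: norm_triangle_ineq4)
      also have "\<dots> \<le> 2 * (e' * (t * M) * M)"
        using R[of t] R[of 0] by simp
      also have "\<dots> = e * t"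
        using M by (simp add: e'_def power2_eq_square)
      finally have "\<bar>h * t\<bar> * norm (f' (p s t) u - f' (p s 0) u - t *\<^sub>R f'' v u) \<le> \<bar>h * t\<bar> * (e * t)"
        by (intro mult_left_mono) auto
      then show "norm (\<psi>' s h) \<le> e * t\<^sup>2 * norm h"
        using t by (simp add: \<psi>'_def abs_mult power2_eq_square mult_ac)
    qed
    have "norm (\<psi> 1 - \<psi> 0) \<le> (e * t\<^sup>2) * norm (1 - 0 :: real)"
      by (rule differentiable_bound[OF _ d\<psi> bound]) auto
    moreover have "\<psi> 1 - \<psi> 0 = f (z + t *\<^sub>R u + t *\<^sub>R v) - f (z + t *\<^sub>R u) - f (z + t *\<^sub>R v) + f z
             - t\<^sup>2 *\<^sub>R f'' v u"
      by (simp add: \<psi>_def p_def add.assoc)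
    ultimately show "norm (f (z + t *\<^sub>R u + t *\<^sub>R v) - f (z + t *\<^sub>R u) - f (z + t *\<^sub>R v) + f z
             - t\<^sup>2 *\<^sub>R f'' v u) \<le> e * t\<^sup>2" by simp
  qed
qed

text \<open>
  The second difference does not change when \<open>u\<close> and \<open>v\<close> are exchanged, whereas its
  limit after division by \<open>t\<^sup>2\<close> is \<open>f'' v u\<close> in one order and \<open>f'' u v\<close> in the other.
\<close>

lemma second_derivative_symmetric:
  fixes f :: "'a::real_normed_vector \<Rightarrow> 'b::real_normed_vector"
    and f' :: "'a \<Rightarrow> 'a \<Rightarrow>\<^sub>L 'b" and f'' :: "'a \<Rightarrow>\<^sub>L 'a \<Rightarrow>\<^sub>L 'b"
  assumes "open D" "z \<in> D"
    and "\<And>w. w \<in> D \<Longrightarrow> (f has_derivative blinfun_apply (f' w)) (at w)"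
    and "(f' has_derivative blinfun_apply f'') (at z)"
  shows "f'' u v = f'' v u"
proof -
  have "norm (f'' u v - f'' v u) \<le> 0 + e" if "e > 0" for e
  proof -
    have e: "e / 2 > 0" using that by simp
    obtain d1 where d1: "d1 > 0" "\<And>t. 0 < t \<Longrightarrow> t < d1 \<Longrightarrow>
       norm (f (z + t *\<^sub>R u + t *\<^sub>R v) - f (z + t *\<^sub>R u) - f (z + t *\<^sub>R v) + f z
             - t\<^sup>2 *\<^sub>R f'' v u) \<le> e / 2 * t\<^sup>2"
      using second_difference_bound[OF assms e] by metis
    obtain d2 where d2: "d2 > 0" "\<And>t. 0 < t \<Longrightarrow> t < d2 \<Longrightarrow>
       norm (f (z + t *\<^sub>R v + t *\<^sub>R u) - f (z + t *\<^sub>R v) - f (z + t *\<^sub>R u) + f z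
             - t\<^sup>2 *\<^sub>R f'' u v) \<le> e / 2 * t\<^sup>2"
      using second_difference_bound[OF assms e] by metis
    define t where "t = min d1 d2 / 2"
    have t: "0 < t" "t < d1" "t < d2" using d1(1) d2(1) by (auto simp: t_def)
    define X where "X = f (z + t *\<^sub>R u + t *\<^sub>R v) - f (z + t *\<^sub>R u) - f (z + t *\<^sub>R v) + f z"
    have "f (z + t *\<^sub>R v + t *\<^sub>R u) - f (z + t *\<^sub>R v) - f (z + t *\<^sub>R u) + f z = X"
      by (simp add: X_def add.assoc add.commute[of "t *\<^sub>R u"])
    then have "norm (X - t\<^sup>2 *\<^sub>R f'' u v) \<le> e / 2 * t\<^sup>2"
      using d2(2)[OF t(1,3)] by simp
    moreover have "norm (X - t\<^sup>2 *\<^sub>R f'' v u) \<le> e / 2 * t\<^sup>2"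
      using d1(2)[OF t(1,2)] by (simp add: X_def)
    moreover have "t\<^sup>2 *\<^sub>R (f'' u v - f'' v u) = (X - t\<^sup>2 *\<^sub>R f'' v u) - (X - t\<^sup>2 *\<^sub>R f'' u v)"
      by (simp add: scaleR_diff_right)
    ultimately have "norm (t\<^sup>2 *\<^sub>R (f'' u v - f'' v u)) \<le> e / 2 * t\<^sup>2 + e / 2 * t\<^sup>2"
      using norm_triangle_ineq4[of "X - t\<^sup>2 *\<^sub>R f'' v u" "X - t\<^sup>2 *\<^sub>R f'' u v"] by simp
    then have "\<bar>t\<^sup>2\<bar> * norm (f'' u v - f'' v u) \<le> e / 2 * t\<^sup>2 + e / 2 * t\<^sup>2"
      by (simp only: norm_scaleR)
    then have "t\<^sup>2 * norm (f'' u v - f'' v u) \<le> t\<^sup>2 * e"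
      by (simp add: mult.commute)
    then show ?thesis using t(1) by simp
  qed
  then have "norm (f'' u v - f'' v u) \<le> 0" by (rule field_le_epsilon)
  then show ?thesis by simp
qed

section \<open>Euler--Lagrange systems of quadratic energies\<close>

lemma partial_deriv_eq:
  assumes "(g has_derivative g') (at z)"
  shows "partial_deriv v g z = g' v"
proof -
  have line: "((\<lambda>t. z + t *\<^sub>R v) has_derivative (\<lambda>t. t *\<^sub>R v)) (at 0)"
    by (auto intro!: derivative_eq_intros)
  have "((\<lambda>t. g (z + t *\<^sub>R v)) has_derivative (\<lambda>t. g' (t *\<^sub>R v))) (at 0)"
    by (rule has_derivative_compose[OF line]) (simp add: assms)
  then have "((\<lambda>t. g (z + t *\<^sub>R v)) has_vector_derivative g' v) (at 0)"
    using linear_scale[OF has_derivative_linear[OF assms]]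
    by (simp add: has_vector_derivative_def)
  then show ?thesis
    unfolding partial_deriv_def by (rule vector_derivative_at)
qed

lemma has_derivative_partial_deriv:
  assumes "open D" "z \<in> D"
    and f': "\<And>w. w \<in> D \<Longrightarrow> (f has_derivative blinfun_apply (f' w)) (at w)"
    and f'': "(f' has_derivative blinfun_apply f'') (at z)"
  shows "(partial_deriv u f has_derivative (\<lambda>h. f'' h u)) (at z)"
proof (rule has_derivative_transform_within_open[OF _ assms(1,2)])
  show "((\<lambda>w. f' w u) has_derivative (\<lambda>h. f'' h u)) (at z)"
    by (rule bounded_linear.has_derivative[OF blinfun.bounded_linear_left f''])
  show "f' w u = partial_deriv u f w" if "w \<in> D" for w
    using partial_deriv_eq[OF f'[OF that]] by simp
qed

lemma vector_4_nth [simp]: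
  "(vector [a, b, c, d] :: 'a::zero ^ 4) $ 1 = a"
  "(vector [a, b, c, d] :: 'a::zero ^ 4) $ 2 = b"
  "(vector [a, b, c, d] :: 'a::zero ^ 4) $ 3 = c"
  "(vector [a, b, c, d] :: 'a::zero ^ 4) $ 4 = d"
  unfolding vector_def by simp_all

text \<open>
  Only the symmetric part of the off-diagonal block \<open>E\<^sub>1\<^sub>2\<close> of an energy matrix enters the
  Euler--Lagrange system, since its antisymmetric part multiplies \<open>f_xy - f_yx = 0\<close>.  For
  \<open>2 \<times> 2\<close> blocks the antisymmetric part is one number \<open>s\<close>; the term it contributes to the
  energy is the null Lagrangian \<open>s (u_x v_y - v_x u_y)\<close>.  In block form the matrix is
  \<open>(A, B + s J; B - s J, C)\<close> with \<open>J = (0, 1; -1, 0)\<close>.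
\<close>

fun energy_matrix :: "system \<Rightarrow> real \<Rightarrow> real^4^4" where
  "energy_matrix (A, B, C) s = vector [
     vector [A$1$1, A$1$2, B$1$1, B$1$2 + s],
     vector [A$2$1, A$2$2, B$2$1 - s, B$2$2],
     vector [B$1$1, B$2$1 - s, C$1$1, C$1$2],
     vector [B$1$2 + s, B$2$2, C$2$1, C$2$2]]"

lemma transpose_eq_iff_2: "transpose (M :: real^2^2) = M \<longleftrightarrow> M$2$1 = M$1$2"
proof
  assume "transpose M = M"
  then have "transpose M $ 1 $ 2 = M $ 1 $ 2" by (rule arg_cong)
  then show "M$2$1 = M$1$2" by (simp add: transpose_def)
next
  assume "M$2$1 = M$1$2"
  then show "transpose M = M" by (simp add: transpose_def vec_eq_iff forall_2)
qed

fun symmetric_system :: "system \<Rightarrow> bool" where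
  "symmetric_system (A, B, C) \<longleftrightarrow> transpose A = A \<and> transpose B = B \<and> transpose C = C"

lemma transpose_energy_matrix:
  "symmetric_system S \<Longrightarrow> transpose (energy_matrix S s) = energy_matrix S s"
  by (cases S) (simp add: transpose_eq_iff_2, simp add: transpose_def vec_eq_iff forall_4)

lemma symmetric_matrix_is_energy_matrix:
  assumes "transpose E = E"
  obtains S s where "symmetric_system S" "E = energy_matrix S s"
proof
  have sym: "E$j$i = E$i$j" for i j
    using arg_cong[OF assms, of "\<lambda>M. M$i$j"] by (simp add: transpose_def)
  let ?S = "(vector [vector [E$1$1, E$1$2], vector [E$1$2, E$2$2]],
             vector [vector [E$1$3, (E$1$4 + E$2$3) / 2], vector [(E$1$4 + E$2$3) / 2, E$2$4]],
             vector [vector [E$3$3, E$3$4], vector [E$3$4, E$4$4]]) :: system"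
  show "symmetric_system ?S" by (simp add: transpose_eq_iff_2)
  show "E = energy_matrix ?S ((E$1$4 - E$2$3) / 2)"
    using sym[of 2 1] sym[of 3 1] sym[of 3 2] sym[of 4 1] sym[of 4 2] sym[of 4 3]
    by (simp add: vec_eq_iff forall_4 field_simps)
qed

lemma partial_deriv_energy_density:
  assumes "transpose E = E"
  shows "partial_deriv v (energy_density E) p = (E *v p) \<bullet> v"
proof -
  have "(energy_density E has_derivative (\<lambda>h. 1/2 * ((E *v p) \<bullet> h + (E *v h) \<bullet> p))) (at p)"
    unfolding energy_density_def
    by (auto intro!: derivative_eq_intros bounded_linear.has_derivative[OF matrix_vector_mul_bounded_linear])
  moreover have "(E *v v) \<bullet> p = (E *v p) \<bullet> v"
    using dot_lmul_matrix[of v E p] transpose_matrix_vector[of E v]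
    by (simp only: assms inner_commute)
  ultimately show ?thesis by (simp add: partial_deriv_eq)
qed

text \<open>
  The fluxes \<open>\<Phi>_(u_x)\<close>, ... are the components of \<open>E \<nabla>f\<close>, so the Euler--Lagrange system is
  \<open>A f_xx + (B + s J) f_xy + (B - s J) f_yx + C f_yy\<close>, and \<open>s\<close> cancels because the mixed
  derivatives agree.
\<close>

lemma euler_lagrange_energy_matrix:
  assumes "open D" "z \<in> D" "C2_on D f" "symmetric_system S"
  shows "euler_lagrange (energy_density (energy_matrix S s)) f z = system_operator S f z"
proof -
  obtain A B C where S: "S = (A, B, C)" by (cases S) auto
  have sym: "A$2$1 = A$1$2" "B$2$1 = B$1$2" "C$2$1 = C$1$2"
    using assms(4) by (simp_all add: S transpose_eq_iff_2)
  let ?E = "energy_matrix S s"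
  obtain f' f'' where f': "\<And>w. w \<in> D \<Longrightarrow> (f has_derivative blinfun_apply (f' w)) (at w)"
    and f'': "\<And>w. w \<in> D \<Longrightarrow> (f' has_derivative blinfun_apply (f'' w)) (at w)"
    using assms(3) unfolding C2_on_def by blast
  note D2 = has_derivative_partial_deriv[OF assms(1,2) f' f''[OF assms(2)]]
  have mixed: "f'' z 1 \<i> = f'' z \<i> 1"
    using second_derivative_symmetric[OF assms(1,2) f' f''[OF assms(2)]] .
  have nth: "((\<lambda>w. partial_deriv u f w $ i) has_derivative (\<lambda>h. f'' z h u $ i)) (at z)" for u i
    by (rule bounded_linear.has_derivative[OF bounded_linear_vec_nth D2])
  have flux: "partial_deriv (axis k 1) (energy_density ?E) (grad f w) =
     ?E$k$1 * dx f w $ 1 + ?E$k$2 * dx f w $ 2 + ?E$k$3 * dy f w $ 1 + ?E$k$4 * dy f w $ 2" for k w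
    by (simp add: partial_deriv_energy_density transpose_energy_matrix assms(4) inner_axis
        matrix_vector_mult_def sum_4 grad_def)
  have dflux: "partial_deriv h (\<lambda>w. partial_deriv (axis k 1) (energy_density ?E) (grad f w)) z =
     ?E$k$1 * f'' z h 1 $ 1 + ?E$k$2 * f'' z h 1 $ 2 + ?E$k$3 * f'' z h \<i> $ 1 + ?E$k$4 * f'' z h \<i> $ 2" for k h
    unfolding flux by (rule partial_deriv_eq) (auto intro!: derivative_eq_intros nth)
  show ?thesis
    unfolding euler_lagrange_def Let_def dflux
    by (simp add: S vec_eq_iff forall_2 partial_deriv_eq[OF D2] matrix_vector_mult_def sum_2 mixed sym
        algebra_simps)
qed

text \<open>
  Quadratic test functions, on which the operator is constant.  They pick out single
  combinations of the coefficients, so that the values of the operator at one point determine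
  the three matrices.
\<close>

lemma system_operator_quadratic:
  fixes \<alpha> \<beta> :: real and c :: "real^2"
  defines "q \<equiv> \<lambda>z. (\<alpha> * Re z + \<beta> * Im z)\<^sup>2 *\<^sub>R c"
  shows "C2_on D q"
    and "system_operator (A, B, C) q z =
      2 *\<^sub>R (\<alpha>\<^sup>2 *\<^sub>R (A *v c) + (2 * \<alpha> * \<beta>) *\<^sub>R (B *v c) + \<beta>\<^sup>2 *\<^sub>R (C *v c))"
proof -
  define l where "l w = \<alpha> * Re w + \<beta> * Im w" for w
  have l: "bounded_linear l"
    unfolding l_def by (intro bounded_linear_add bounded_linear_const_mult bounded_linear_Re bounded_linear_Im)
  define L where "L = Blinfun (\<lambda>w. l w *\<^sub>R c)"
  have L: "blinfun_apply L = (\<lambda>w. l w *\<^sub>R c)"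
    unfolding L_def by (intro bounded_linear_Blinfun_apply bounded_linear_scaleR_const l)
  define H where "H = Blinfun (\<lambda>h. (2 * l h) *\<^sub>R L)"
  have H: "blinfun_apply H = (\<lambda>h. (2 * l h) *\<^sub>R L)"
    unfolding H_def
    by (intro bounded_linear_Blinfun_apply bounded_linear_scaleR_const bounded_linear_const_mult l)
  note dl = bounded_linear.has_derivative[OF l has_derivative_ident]
  have q: "q = (\<lambda>w. (l w)\<^sup>2 *\<^sub>R c)" by (simp add: q_def l_def)
  have q': "(q has_derivative blinfun_apply ((2 * l w) *\<^sub>R L)) (at w)" for w
    unfolding q by (auto intro!: derivative_eq_intros dl simp: blinfun.bilinear_simps L)
  have q'': "((\<lambda>w. (2 * l w) *\<^sub>R L) has_derivative blinfun_apply H) (at w)" for w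
    unfolding H by (auto intro!: derivative_eq_intros dl)
  show "C2_on D q"
    unfolding C2_on_def using q' q''
    by (intro exI[of _ "\<lambda>w. (2 * l w) *\<^sub>R L"] exI[of _ "\<lambda>_. H"]) auto
  have D2: "partial_deriv h (partial_deriv u q) z = (2 * l h * l u) *\<^sub>R c" for h u
    using partial_deriv_eq[OF has_derivative_partial_deriv[OF open_UNIV UNIV_I q' q'']]
    by (simp add: H L blinfun.bilinear_simps)
  show "system_operator (A, B, C) q z =
      2 *\<^sub>R (\<alpha>\<^sup>2 *\<^sub>R (A *v c) + (2 * \<alpha> * \<beta>) *\<^sub>R (B *v c) + \<beta>\<^sup>2 *\<^sub>R (C *v c))"
    by (simp add: D2 l_def matrix_vector_mult_scaleR scaleR_add_right power2_eq_square mult_ac)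
qed

lemma system_determined_by_operator:
  assumes "D \<noteq> {}"
    and "\<And>f z. C2_on D f \<Longrightarrow> z \<in> D \<Longrightarrow> system_operator S f z = system_operator S' f z"
  shows "S = S'"
proof -
  obtain A B C A' B' C' where S: "S = (A, B, C)" "S' = (A', B', C')"
    by (cases S, cases S') auto
  obtain z where z: "z \<in> D" using assms(1) by auto
  have eq: "\<alpha>\<^sup>2 *\<^sub>R (A *v c) + (2 * \<alpha> * \<beta>) *\<^sub>R (B *v c) + \<beta>\<^sup>2 *\<^sub>R (C *v c) =
            \<alpha>\<^sup>2 *\<^sub>R (A' *v c) + (2 * \<alpha> * \<beta>) *\<^sub>R (B' *v c) + \<beta>\<^sup>2 *\<^sub>R (C' *v c)" for \<alpha> \<beta> c
    using assms(2)[OF system_operator_quadratic(1) z]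
    unfolding S system_operator_quadratic(2) by simp
  have "A = A'" "C = C'"
    using eq[of 1 _ 0] eq[of 0 _ 1] by (auto simp: matrix_eq)
  moreover from this have "B = B'"
    using eq[of 1 _ 1] by (auto simp: matrix_eq)
  ultimately show ?thesis by (simp add: S)
qed

lemma is_euler_lagrange_system_energy_matrix:
  assumes "open D" "D \<noteq> {}" "symmetric_system S'"
  shows "is_euler_lagrange_system D (energy_matrix S' s) S \<longleftrightarrow> S = S'"
proof
  assume "is_euler_lagrange_system D (energy_matrix S' s) S"
  then have "system_operator S f z = system_operator S' f z" if "C2_on D f" "z \<in> D" for f z
    using that euler_lagrange_energy_matrix[OF assms(1) that(2,1) assms(3)]
    by (simp add: is_euler_lagrange_system_def)
  then show "S = S'" by (rule system_determined_by_operator[OF assms(2)])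
qed (simp add: is_euler_lagrange_system_def euler_lagrange_energy_matrix[OF assms(1)] assms(3))

lemma jordan_domain_open_nonempty:
  assumes "jordan_domain D"
  shows "open D" "D \<noteq> {}"
proof -
  obtain g :: "real \<Rightarrow> complex" where g: "simple_path g" "pathfinish g = pathstart g"
    and D: "D = inside (path_image g)"
    using assms unfolding jordan_domain_def by blast
  show "open D"
    unfolding D by (simp add: open_inside closed_path_image simple_path_imp_path g)
  show "D \<noteq> {}"
    unfolding D using Jordan_inside_outside[OF g] by simp
qed

text \<open>
  Twice the energy density, as a quadratic form in \<open>p = f_x\<close> and \<open>q = f_y\<close>.  Keeping the two derivatives
  apart makes both kinds of substitutions, in \<open>(x, y)\<close> and in \<open>(u, v)\<close>, act by simple formulas.
\<close>

fun energy_form :: "system \<Rightarrow> real \<Rightarrow> real^2 \<Rightarrow> real^2 \<Rightarrow> real" where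
  "energy_form (A, B, C) s p q =
     (A *v p) \<bullet> p + 2 * ((B *v q) \<bullet> p) + (C *v q) \<bullet> q + 2 * s * (p$1 * q$2 - p$2 * q$1)"

lemma energy_matrix_inner:
  assumes "symmetric_system S"
  shows "(energy_matrix S s *v v) \<bullet> v = energy_form S s (vector [v$1, v$2]) (vector [v$3, v$4])"
proof -
  obtain A B C where S: "S = (A, B, C)" by (cases S) auto
  have "A$2$1 = A$1$2" "B$2$1 = B$1$2" "C$2$1 = C$1$2"
    using assms by (simp_all add: S transpose_eq_iff_2)
  then show ?thesis
    by (simp add: S inner_vec_def matrix_vector_mult_def sum_2 sum_4 algebra_simps)
qed

lemma nonneg_definite_energy_matrix:
  assumes "symmetric_system S"
  shows "nonneg_definite (energy_matrix S s) \<longleftrightarrow> (\<forall>p q. 0 \<le> energy_form S s p q)"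
proof
  assume nonneg: "nonneg_definite (energy_matrix S s)"
  show "\<forall>p q. 0 \<le> energy_form S s p q"
  proof (intro allI)
    fix p q :: "real^2"
    have "vector [p$1, p$2] = p" "vector [q$1, q$2] = q"
      by (simp_all add: vec_eq_iff forall_2)
    then show "0 \<le> energy_form S s p q"
      using energy_matrix_inner[OF assms, of s "vector [p$1, p$2, q$1, q$2]"] nonneg
      by (simp add: nonneg_definite_def) metis
  qed
qed (simp add: nonneg_definite_def energy_matrix_inner[OF assms])

section \<open>Admissible transformations\<close>

fun combine :: "real^2^2 \<Rightarrow> system \<Rightarrow> system" where
  "combine P (A, B, C) = (P ** A, P ** B, P ** C)"

fun substitute :: "real^2^2 \<Rightarrow> system \<Rightarrow> system" where
  "substitute Q (A, B, C) = (A ** Q, B ** Q, C ** Q)"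

fun change_vars :: "real^2^2 \<Rightarrow> system \<Rightarrow> system" where
  "change_vars T (A, B, C) =
     ((T$1$1)\<^sup>2 *\<^sub>R A + (2 * T$1$1 * T$1$2) *\<^sub>R B + (T$1$2)\<^sup>2 *\<^sub>R C,
      (T$1$1 * T$2$1) *\<^sub>R A + (T$1$1 * T$2$2 + T$1$2 * T$2$1) *\<^sub>R B + (T$1$2 * T$2$2) *\<^sub>R C,
      (T$2$1)\<^sup>2 *\<^sub>R A + (2 * T$2$1 * T$2$2) *\<^sub>R B + (T$2$2)\<^sup>2 *\<^sub>R C)"

lemma admissible_step_iff:
  "admissible_step S S' \<longleftrightarrow>
     (\<exists>T. det T \<noteq> 0 \<and> (S' = change_vars T S \<or> S' = substitute T S \<or> S' = combine T S))"
proof -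
  obtain A B C where S: "S = (A, B, C)" by (cases S) auto
  show ?thesis
    unfolding S admissible_step.simps[of "(A, B, C)"] by auto
qed

lemma matrix_entries_mult_2:
  "((M :: real^2^2) ** N) $ i $ j = M$i$1 * N$1$j + M$i$2 * N$2$j"
  by (simp add: matrix_matrix_mult_def sum_2)

lemma change_vars_compose: "change_vars U (change_vars T S) = change_vars (U ** T) S"
  by (cases S) (simp add: vec_eq_iff forall_2 matrix_entries_mult_2 algebra_simps power2_eq_square)

lemma change_vars_id: "change_vars (mat 1) S = S"
  by (cases S) (simp add: mat_def)

lemma combine_change_vars: "combine P (change_vars T S) = change_vars T (combine P S)"
  by (cases S) (simp add: vec_eq_iff forall_2 matrix_entries_mult_2 algebra_simps)

lemma obtain_matrix_inverse:
  fixes T :: "real^2^2"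
  assumes "det T \<noteq> 0"
  obtains T' where "T ** T' = mat 1" "T' ** T = mat 1" "det T' \<noteq> 0"
proof -
  obtain T' where T': "T ** T' = mat 1" "T' ** T = mat 1"
    using assms invertible_det_nz[of T] unfolding invertible_def by blast
  then have "det T * det T' = 1" by (metis det_I det_mul)
  then have "det T' \<noteq> 0" by auto
  then show thesis by (rule that[OF T'])
qed

lemma admissible_step_sym:
  assumes "admissible_step S S'"
  shows "admissible_step S' S"
proof -
  obtain A B C where S: "S = (A, B, C)" by (cases S) auto
  obtain T where T: "det T \<noteq> 0"
    and S': "S' = change_vars T S \<or> S' = substitute T S \<or> S' = combine T S"
    using assms admissible_step_iff by auto
  obtain T' where T': "T ** T' = mat 1" "T' ** T = mat 1" "det T' \<noteq> 0"
    using obtain_matrix_inverse[OF T] .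
  have "S = change_vars T' (change_vars T S)"
    by (simp add: change_vars_compose T' change_vars_id)
  moreover have "S = substitute T' (substitute T S)" "S = combine T' (combine T S)"
    by (simp_all add: S T' matrix_mul_assoc matrix_mul_assoc[symmetric, of _ T T'])
  ultimately show ?thesis
    using S' T'(3) unfolding admissible_step_iff by metis
qed

text \<open>
  Since every step can be undone, it suffices to check that a property is preserved by steps in
  one direction.
\<close>

lemma reduces_to_invariant:
  assumes "reduces_to S S'" and "\<And>S S'. admissible_step S S' \<Longrightarrow> X S \<Longrightarrow> X S'"
  shows "X S \<longleftrightarrow> X S'"
  using assms(1) unfolding reduces_to_def
  by (induction rule: rtranclp_induct) (use assms(2) admissible_step_sym in blast)+

section \<open>Invariance of being variational and of strong ellipticity\<close>

text \<open>
  The matrix content of being the Euler--Lagrange system of a nonnegative energy, up to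
  recombination of the equations.  The null Lagrangian coefficient \<open>s\<close> leaves the equations
  as they are but can be used to make the energy nonnegative.
\<close>

definition variational :: "system \<Rightarrow> bool" where
  "variational S \<longleftrightarrow> (\<exists>P s. det P \<noteq> 0 \<and> symmetric_system (combine P S) \<and>
     (\<forall>p q. 0 \<le> energy_form (combine P S) s p q))"

text \<open>
  Under a linear substitution of \<open>(x, y)\<close> the pair \<open>(p, q)\<close> is transformed by \<open>T\<^sup>t\<close>, and the
  null Lagrangian, being a determinant in \<open>p\<close> and \<open>q\<close>, is multiplied by \<open>det T\<close>.
\<close>

lemma energy_form_change_vars:
  assumes "symmetric_system S"
  shows "energy_form (change_vars T S) (s * det T) p q =
    energy_form S s (T$1$1 *\<^sub>R p + T$2$1 *\<^sub>R q) (T$1$2 *\<^sub>R p + T$2$2 *\<^sub>R q)"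
proof -
  obtain A B C where S: "S = (A, B, C)" by (cases S) auto
  have "A$2$1 = A$1$2" "B$2$1 = B$1$2" "C$2$1 = C$1$2"
    using assms by (simp_all add: S transpose_eq_iff_2)
  then show ?thesis
    by (simp add: S inner_vec_def matrix_vector_mult_def sum_2 det_2 algebra_simps power2_eq_square)
qed

text \<open>
  Substituting \<open>f = Q g\<close> in the energy multiplies the equations by \<open>Q\<^sup>t\<close> as well; this is why
  a change of the unknowns alone can destroy symmetry, and why equations must be allowed to be
  recombined.
\<close>

lemma energy_form_congruence:
  "energy_form (combine (transpose Q) (substitute Q S)) (s * det Q) p q =
     energy_form S s (Q *v p) (Q *v q)"
  by (cases S) (simp add: inner_vec_def matrix_vector_mult_def matrix_entries_mult_2 transpose_def
      sum_2 det_2 algebra_simps)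

lemma symmetric_system_change_vars: "symmetric_system S \<Longrightarrow> symmetric_system (change_vars T S)"
  by (cases S) (simp add: transpose_eq_iff_2)

lemma symmetric_system_congruence:
  "symmetric_system S \<Longrightarrow> symmetric_system (combine (transpose Q) (substitute Q S))"
  by (cases S) (simp add: matrix_transpose_mul transpose_transpose matrix_mul_assoc)

lemma combine_combine: "combine P (combine R S) = combine (P ** R) S"
  by (cases S) (simp add: matrix_mul_assoc)

lemma combine_substitute: "combine P (substitute Q S) = substitute Q (combine P S)"
  by (cases S) (simp add: matrix_mul_assoc)

text \<open>
  An energy for the transformed system is the old energy in the new variables or unknowns,
  which is nonnegative because the old one is.
\<close>

lemma variational_step:
  assumes "admissible_step S S'" "variational S"
  shows "variational S'"
proof -
  obtain P s where P: "det P \<noteq> 0" "symmetric_system (combine P S)"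
    and nonneg: "\<And>p q. 0 \<le> energy_form (combine P S) s p q"
    using assms(2) unfolding variational_def by blast
  obtain T where T: "det T \<noteq> 0"
    and S': "S' = change_vars T S \<or> S' = substitute T S \<or> S' = combine T S"
    using assms(1) admissible_step_iff by auto
  from S' show ?thesis
  proof (elim disjE)
    assume S': "S' = change_vars T S"
    show ?thesis unfolding variational_def
      using P nonneg
      by (intro exI[of _ P] exI[of _ "s * det T"])
        (simp add: S' combine_change_vars symmetric_system_change_vars energy_form_change_vars)
  next
    assume S': "S' = substitute T S"
    have "combine (transpose T ** P) S' = combine (transpose T) (substitute T (combine P S))"
      by (simp add: S' combine_combine[symmetric] combine_substitute)
    then show ?thesis unfolding variational_def
      using P nonneg T
      by (intro exI[of _ "transpose T ** P"] exI[of _ "s * det T"])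
        (simp only: symmetric_system_congruence energy_form_congruence, simp add: det_mul det_transpose)
  next
    assume S': "S' = combine T S"
    obtain T' where T': "T' ** T = mat 1" "det T' \<noteq> 0"
      using obtain_matrix_inverse[OF T] by metis
    have "combine (P ** T') S' = combine P S"
      by (simp add: S' combine_combine T' flip: matrix_mul_assoc)
    then show ?thesis unfolding variational_def
      using P nonneg T' by (intro exI[of _ "P ** T'"] exI[of _ s]) (simp add: det_mul)
  qed
qed

text \<open>
  The triple \<open>(\<alpha>, \<beta>, \<gamma>)\<close> is the quadratic form \<open>\<alpha> \<xi>\<^sup>2 + 2 \<beta> \<xi> \<eta> + \<gamma> \<eta>\<^sup>2\<close>, and
  \<open>\<beta>\<^sup>2 < \<alpha> \<gamma>\<close> says that it is definite.  An elliptic system with this property is strongly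
  elliptic.
\<close>

fun definite_regular :: "system \<Rightarrow> bool" where
  "definite_regular (A, B, C) \<longleftrightarrow> (\<forall>\<alpha> \<beta> \<gamma> :: real.
     \<beta>\<^sup>2 - \<alpha> * \<gamma> < 0 \<longrightarrow> det (\<alpha> *\<^sub>R A + (2 * \<beta>) *\<^sub>R B + \<gamma> *\<^sub>R C) \<noteq> 0)"

text \<open>
  A change of variables moves \<open>T\<close> from the matrices to the form: \<open>(\<alpha>, \<beta>, \<gamma>)\<close>, read as a
  symmetric \<open>2 \<times> 2\<close> matrix \<open>F\<close>, is replaced by \<open>T\<^sup>t F T\<close>, which is definite with \<open>F\<close>.  The
  other two kinds of transformations multiply the determinant by a nonzero constant.
\<close>

lemma definite_regular_step:
  assumes "admissible_step S S'" "definite_regular S"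
  shows "definite_regular S'"
proof -
  obtain A B C where S: "S = (A, B, C)" by (cases S) auto
  obtain A' B' C' where S'eq: "S' = (A', B', C')" by (cases S') auto
  have reg: "det (\<alpha> *\<^sub>R A + (2 * \<beta>) *\<^sub>R B + \<gamma> *\<^sub>R C) \<noteq> 0" if "\<beta>\<^sup>2 - \<alpha> * \<gamma> < 0" for \<alpha> \<beta> \<gamma>
    using that assms(2) by (simp add: S)
  obtain T where T: "det T \<noteq> 0"
    and S': "S' = change_vars T S \<or> S' = substitute T S \<or> S' = combine T S"
    using assms(1) admissible_step_iff by auto
  have "det (\<alpha> *\<^sub>R A' + (2 * \<beta>) *\<^sub>R B' + \<gamma> *\<^sub>R C') \<noteq> 0" if neg: "\<beta>\<^sup>2 - \<alpha> * \<gamma> < 0" for \<alpha> \<beta> \<gamma>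
    using S'
  proof (elim disjE)
    assume S': "S' = change_vars T S"
    define \<alpha>' where "\<alpha>' = \<alpha> * (T$1$1)\<^sup>2 + 2 * \<beta> * T$1$1 * T$2$1 + \<gamma> * (T$2$1)\<^sup>2"
    define \<beta>' where "\<beta>' = \<alpha> * T$1$1 * T$1$2 + \<beta> * (T$1$1 * T$2$2 + T$1$2 * T$2$1) + \<gamma> * T$2$1 * T$2$2"
    define \<gamma>' where "\<gamma>' = \<alpha> * (T$1$2)\<^sup>2 + 2 * \<beta> * T$1$2 * T$2$2 + \<gamma> * (T$2$2)\<^sup>2"
    have "\<beta>'\<^sup>2 - \<alpha>' * \<gamma>' = (det T)\<^sup>2 * (\<beta>\<^sup>2 - \<alpha> * \<gamma>)"
      by (simp add: \<alpha>'_def \<beta>'_def \<gamma>'_def det_2 algebra_simps power2_eq_square)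
    then have "\<beta>'\<^sup>2 - \<alpha>' * \<gamma>' < 0"
      using neg T by (simp add: mult_pos_neg)
    moreover have "\<alpha> *\<^sub>R A' + (2 * \<beta>) *\<^sub>R B' + \<gamma> *\<^sub>R C' = \<alpha>' *\<^sub>R A + (2 * \<beta>') *\<^sub>R B + \<gamma>' *\<^sub>R C"
      using S' by (simp add: S S'eq \<alpha>'_def \<beta>'_def \<gamma>'_def vec_eq_iff forall_2 algebra_simps)
    ultimately show ?thesis using reg by simp
  next
    assume S': "S' = substitute T S"
    have "\<alpha> *\<^sub>R A' + (2 * \<beta>) *\<^sub>R B' + \<gamma> *\<^sub>R C' = (\<alpha> *\<^sub>R A + (2 * \<beta>) *\<^sub>R B + \<gamma> *\<^sub>R C) ** T"
      using S' by (simp add: S S'eq vec_eq_iff forall_2 matrix_entries_mult_2 algebra_simps)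
    then show ?thesis using reg[OF neg] T by (simp add: det_mul)
  next
    assume S': "S' = combine T S"
    have "\<alpha> *\<^sub>R A' + (2 * \<beta>) *\<^sub>R B' + \<gamma> *\<^sub>R C' = T ** (\<alpha> *\<^sub>R A + (2 * \<beta>) *\<^sub>R B + \<gamma> *\<^sub>R C)"
      using S' by (simp add: S S'eq vec_eq_iff forall_2 matrix_entries_mult_2 algebra_simps)
    then show ?thesis using reg[OF neg] T by (simp add: det_mul)
  qed
  then show ?thesis by (simp add: S'eq)
qed

text \<open>
  The Euler--Lagrange system determines a symmetric energy matrix up to the coefficient \<open>s\<close>
  of the null Lagrangian, so the search for an energy reduces to the choice of \<open>P\<close> and \<open>s\<close>.
\<close>

lemma ex_energy_iff_variational:
  assumes "open D" "D \<noteq> {}"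
  shows "(\<exists>E P. transpose E = E \<and> nonneg_definite E \<and> det P \<noteq> 0 \<and>
            is_euler_lagrange_system D E (combine P S)) \<longleftrightarrow> variational S"
proof
  assume "\<exists>E P. transpose E = E \<and> nonneg_definite E \<and> det P \<noteq> 0 \<and>
            is_euler_lagrange_system D E (combine P S)"
  then obtain E P where EP: "transpose E = E" "nonneg_definite E" "det P \<noteq> 0"
    "is_euler_lagrange_system D E (combine P S)" by blast
  obtain S' s where S': "symmetric_system S'" "E = energy_matrix S' s"
    using symmetric_matrix_is_energy_matrix[OF EP(1)] .
  have "combine P S = S'"
    using is_euler_lagrange_system_energy_matrix[OF assms S'(1)] EP(4) S'(2) by blast
  then show "variational S"
    unfolding variational_def using EP S' nonneg_definite_energy_matrix[OF S'(1)] by blast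
next
  assume "variational S"
  then obtain P s where P: "det P \<noteq> 0" "symmetric_system (combine P S)"
    and "\<forall>p q. 0 \<le> energy_form (combine P S) s p q"
    unfolding variational_def by blast
  then have "nonneg_definite (energy_matrix (combine P S) s)"
    using nonneg_definite_energy_matrix by blast
  then show "\<exists>E P. transpose E = E \<and> nonneg_definite E \<and> det P \<noteq> 0 \<and>
            is_euler_lagrange_system D E (combine P S)"
    using P transpose_energy_matrix[OF P(2)]
      is_euler_lagrange_system_energy_matrix[OF assms P(2)] by blast
qed

section \<open>The canonical systems\<close>

lemma quadratic_form_nonneg:
  fixes a m c x y :: real
  assumes "a > 0" "m\<^sup>2 \<le> a * c"
  shows "0 \<le> a * x\<^sup>2 + 2 * m * x * y + c * y\<^sup>2"
proof -
  have "a * (a * x\<^sup>2 + 2 * m * x * y + c * y\<^sup>2) = (a * x + m * y)\<^sup>2 + (a * c - m\<^sup>2) * y\<^sup>2"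
    by (simp add: algebra_simps power2_eq_square)
  also have "\<dots> \<ge> 0" using assms(2) by simp
  finally show ?thesis using assms(1) by (simp add: zero_le_mult_iff)
qed

text \<open>
  With \<open>b\<close> the lower left entry of the canonical \<open>B\<close>, symmetry of \<open>P B\<close> forces
  \<open>P\<^sub>1\<^sub>1 = b P\<^sub>2\<^sub>2\<close>.  Restricting the energy to gradients with \<open>q = 0\<close> or \<open>p = 0\<close> shows that the
  diagonal entries of \<open>P\<close> and of \<open>P C\<close> are nonnegative, which leaves only \<open>b > 0\<close> and
  \<open>lam > 0\<close>; for positive \<open>lam\<close> the sign of \<open>b\<close> is that of \<open>\<kappa>\<^sup>2 - lam\<close>.
\<close>

lemma variational_canonical_imp:
  assumes "\<kappa> \<in> {0<..1}" "lam \<in> {-\<kappa>..\<kappa>} - {0, \<kappa>\<^sup>2}" "variational (canonical_system \<kappa> lam)"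
  shows "0 < lam" "lam < \<kappa>\<^sup>2"
proof -
  define \<mu> where "\<mu> = \<kappa>\<^sup>2 / lam"
  define b where "b = - (1/4) * (1 - lam) * (1 - \<mu>)"
  have S: "canonical_system \<kappa> lam = (vector [vector [1, 0], vector [0, 1]],
      vector [vector [0, 1], vector [b, 0]], vector [vector [lam, 0], vector [0, \<mu>]])"
    by (simp add: canonical_system_def b_def \<mu>_def)
  have range: "0 < \<kappa>" "\<kappa> \<le> 1" "lam \<le> \<kappa>" "lam \<noteq> 0" "lam \<noteq> \<kappa>\<^sup>2"
    using assms(1,2) by auto
  \<comment> \<open>\<open>lam = 1\<close> would give \<open>\<kappa> = 1 = lam = \<kappa>\<^sup>2\<close>.\<close>
  have "lam \<noteq> 1"
  proof
    assume "lam = 1"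
    then have "\<kappa> = 1" using range by simp
    then show False using \<open>lam = 1\<close> range by simp
  qed
  then have lam1: "lam < 1" using range by simp
  have "\<mu> \<noteq> 1" using range by (simp add: \<mu>_def)
  then have b0: "b \<noteq> 0" using lam1 by (simp add: b_def)
  let ?S = "canonical_system \<kappa> lam"
  obtain P s where P: "det P \<noteq> 0" "symmetric_system (combine P ?S)"
    and nonneg: "\<And>p q. 0 \<le> energy_form (combine P ?S) s p q"
    using assms(3) unfolding variational_def by blast
  have sym: "P$2$1 = P$1$2" "P$1$1 = P$2$2 * b"
    using P(2) by (simp_all add: S transpose_eq_iff_2 matrix_entries_mult_2)
  note form = S inner_vec_def matrix_vector_mult_def sum_2 matrix_entries_mult_2
  have P11: "P$1$1 \<ge> 0" and P22: "P$2$2 \<ge> 0" and P11lam: "P$1$1 * lam \<ge> 0"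
    using nonneg[of "vector [1, 0]" 0] nonneg[of "vector [0, 1]" 0] nonneg[of 0 "vector [1, 0]"]
    by (simp_all add: form)
  \<comment> \<open>A nonnegative symmetric \<open>P\<close> with zero diagonal vanishes.\<close>
  have "P$1$1 \<noteq> 0"
  proof
    assume "P$1$1 = 0"
    moreover from this have "P$2$2 = 0" using sym b0 by simp
    moreover from calculation have "P$1$2 = 0"
      using sym nonneg[of "vector [1, 1]" 0] nonneg[of "vector [1, -1]" 0]
      by (simp add: form)
    ultimately show False using P(1) by (simp add: det_2)
  qed
  then have P11pos: "P$1$1 > 0" using P11 by simp
  then show lam: "0 < lam"
    using P11lam range by (simp add: zero_le_mult_iff)
  have "P$2$2 > 0" using P22 P11pos sym by (cases "P$2$2 = 0") auto
  then have "b > 0" using P11pos sym by (simp add: zero_less_mult_iff)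
  moreover have "4 * b = (1 - lam) * (\<mu> - 1)"
    unfolding b_def by algebra
  ultimately have "0 < (1 - lam) * (\<mu> - 1)" by linarith
  then have "\<mu> > 1"
    using lam1 by (simp add: zero_less_mult_iff)
  then show "lam < \<kappa>\<^sup>2" using lam by (simp add: \<mu>_def field_simps)
qed

lemma energy_form_antidiagonal:
  "energy_form (vector [vector [b, 0], vector [0, 1]], vector [vector [0, b], vector [b, 0]],
      vector [vector [b * lam, 0], vector [0, \<mu>]]) s p q =
    (b * (p$1)\<^sup>2 + 2 * (b + s) * p$1 * q$2 + \<mu> * (q$2)\<^sup>2) +
    (1 * (p$2)\<^sup>2 + 2 * (b - s) * p$2 * q$1 + b * lam * (q$1)\<^sup>2)"
  by (simp add: inner_vec_def matrix_vector_mult_def sum_2 algebra_simps power2_eq_square)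

text \<open>
  With \<open>P = diag(b, 1)\<close> all three matrices become symmetric and the energy splits into a form
  in \<open>(u_x, v_y)\<close> with mixed coefficient \<open>b + s\<close> and a form in \<open>(v_x, u_y)\<close> with mixed
  coefficient \<open>b - s\<close>.  They are nonnegative if \<open>(b + s)\<^sup>2 \<le> b \<mu>\<close> and \<open>(b - s)\<^sup>2 \<le> b lam\<close>,
  where \<open>\<mu> = \<kappa>\<^sup>2 / lam\<close>.  Such an \<open>s\<close> exists once \<open>2 b \<le> sqrt (b \<mu>) + sqrt (b lam)\<close>, that is,
  \<open>4 b \<le> (sqrt \<mu> + sqrt lam)\<^sup>2\<close>; the difference of the two sides is \<open>(1 + \<kappa>)\<^sup>2\<close>.
\<close>

lemma variational_canonical:
  assumes "0 < \<kappa>" "\<kappa> \<le> 1" "0 < lam" "lam < \<kappa>\<^sup>2"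
  shows "variational (canonical_system \<kappa> lam)"
proof -
  define \<mu> where "\<mu> = \<kappa>\<^sup>2 / lam"
  define b where "b = - (1/4) * (1 - lam) * (1 - \<mu>)"
  have S: "canonical_system \<kappa> lam = (vector [vector [1, 0], vector [0, 1]],
      vector [vector [0, 1], vector [b, 0]], vector [vector [lam, 0], vector [0, \<mu>]])"
    by (simp add: canonical_system_def b_def \<mu>_def)
  have "\<kappa>\<^sup>2 \<le> 1" using assms by (simp add: power_le_one)
  then have lam1: "lam < 1" using assms by simp
  have \<mu>1: "\<mu> > 1" using assms by (simp add: \<mu>_def)
  have lam\<mu>: "lam * \<mu> = \<kappa>\<^sup>2" using assms by (simp add: \<mu>_def)
  have b4: "4 * b = (1 - lam) * (\<mu> - 1)"
    unfolding b_def by algebra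
  then have b: "b > 0" using lam1 \<mu>1 by (smt (verit) mult_pos_pos)
  define x where "x = sqrt \<mu>"
  define y where "y = sqrt lam"
  have x: "x > 0" "x\<^sup>2 = \<mu>" and y: "y > 0" "y\<^sup>2 = lam"
    using \<mu>1 assms by (auto simp: x_def y_def)
  have xy: "x * y = \<kappa>"
    using lam\<mu> assms by (simp add: x_def y_def flip: real_sqrt_mult) (simp add: mult.commute)
  have d: "x + y > 0" using x y by simp
  have "(x + y)\<^sup>2 = \<mu> + lam + 2 * \<kappa>"
    using x y xy by (simp add: power2_sum)
  moreover have "4 * b = \<mu> + lam - 1 - \<kappa>\<^sup>2"
    unfolding b4 lam\<mu>[symmetric] by (simp add: algebra_simps)
  moreover have "1 + \<kappa>\<^sup>2 + 2 * \<kappa> \<ge> 0" using assms by simp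
  ultimately have d4: "4 * b \<le> (x + y)\<^sup>2" by linarith
  \<comment> \<open>This \<open>s\<close> divides \<open>2 b = (b + s) + (b - s)\<close> in the ratio of the two bounds
      \<open>sqrt (b \<mu>)\<close> and \<open>sqrt (b lam)\<close>.\<close>
  define s where "s = b * (x - y) / (x + y)"
  have bs: "b + s = 2 * b * x / (x + y)" "b - s = 2 * b * y / (x + y)"
    using d by (simp_all add: s_def field_simps)
  have sq: "(2 * b * r / (x + y))\<^sup>2 \<le> b * r\<^sup>2" for r
  proof -
    have "(2 * b * r / (x + y))\<^sup>2 = (4 * b) / (x + y)\<^sup>2 * (b * r\<^sup>2)"
      by (simp add: power2_eq_square)
    also have "\<dots> \<le> 1 * (b * r\<^sup>2)"
      using d4 d b by (intro mult_right_mono) simp_all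
    finally show ?thesis by simp
  qed
  let ?P = "vector [vector [b, 0], vector [0, 1]] :: real^2^2"
  let ?S = "combine ?P (canonical_system \<kappa> lam)"
  have PS: "?S = (vector [vector [b, 0], vector [0, 1]], vector [vector [0, b], vector [b, 0]],
      vector [vector [b * lam, 0], vector [0, \<mu>]])"
    by (simp add: S vec_eq_iff forall_2 matrix_entries_mult_2)
  have "0 \<le> energy_form ?S s p q" for p q
  proof -
    have "energy_form ?S s p q =
        (b * (p$1)\<^sup>2 + 2 * (b + s) * p$1 * q$2 + \<mu> * (q$2)\<^sup>2) +
        (1 * (p$2)\<^sup>2 + 2 * (b - s) * p$2 * q$1 + b * lam * (q$1)\<^sup>2)"
      unfolding PS by (rule energy_form_antidiagonal)
    also have "\<dots> \<ge> 0"
      using sq[of x] sq[of y] b x y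
      by (intro add_nonneg_nonneg quadratic_form_nonneg) (simp_all add: bs)
    finally show ?thesis .
  qed
  moreover have "symmetric_system ?S"
    unfolding PS by (simp add: transpose_eq_iff_2)
  moreover have "det ?P \<noteq> 0" using b by (simp add: det_2)
  ultimately show ?thesis unfolding variational_def by blast
qed

text \<open>
  For \<open>lam > 0\<close> the determinant is a sum of nonnegative terms and of
  \<open>(lam + \<mu>) (\<alpha> \<gamma> - \<beta>\<^sup>2) > 0\<close>.  For \<open>lam < 0\<close> the definite form \<open>(-lam, 0, 1)\<close> annihilates
  the first row of the matrix.
\<close>

lemma definite_regular_canonical:
  assumes "\<kappa> > 0" "lam \<noteq> 0"
  shows "definite_regular (canonical_system \<kappa> lam) \<longleftrightarrow> lam > 0"
proof -
  define \<mu> where "\<mu> = \<kappa>\<^sup>2 / lam"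
  have lam\<mu>: "lam * \<mu> = \<kappa>\<^sup>2" using assms by (simp add: \<mu>_def)
  define b where "b = - (1/4) * (1 - lam) * (1 - \<mu>)"
  have S: "canonical_system \<kappa> lam = (vector [vector [1, 0], vector [0, 1]],
      vector [vector [0, 1], vector [b, 0]], vector [vector [lam, 0], vector [0, \<mu>]])"
    by (simp add: canonical_system_def b_def \<mu>_def)
  have b4: "4 * b = lam + \<mu> - 1 - \<kappa>\<^sup>2"
    unfolding b_def lam\<mu>[symmetric] by algebra
  define d where "d \<alpha> \<beta> \<gamma> = (\<alpha> + \<gamma> * lam) * (\<alpha> + \<gamma> * \<mu>) - (4 * b) * \<beta>\<^sup>2" for \<alpha> \<beta> \<gamma>
  have reg: "definite_regular (canonical_system \<kappa> lam) \<longleftrightarrow>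
      (\<forall>\<alpha> \<beta> \<gamma>. \<beta>\<^sup>2 - \<alpha> * \<gamma> < 0 \<longrightarrow> d \<alpha> \<beta> \<gamma> \<noteq> 0)"
  proof -
    have "det (\<alpha> *\<^sub>R vector [vector [1, 0], vector [0, 1]]
        + (2 * \<beta>) *\<^sub>R vector [vector [0, 1], vector [b, 0]]
        + \<gamma> *\<^sub>R vector [vector [lam, 0], vector [0, \<mu>]] :: real^2^2) = d \<alpha> \<beta> \<gamma>" for \<alpha> \<beta> \<gamma>
      by (simp add: det_2 d_def power2_eq_square algebra_simps)
    then show ?thesis
      by (simp only: S definite_regular.simps)
  qed
  show ?thesis
  proof
    assume "definite_regular (canonical_system \<kappa> lam)"
    then have "0\<^sup>2 - (-lam) * 1 < 0 \<longrightarrow> d (-lam) 0 1 \<noteq> 0"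
      unfolding reg by blast
    then show "lam > 0" using assms by (auto simp: d_def)
  next
    assume lam: "lam > 0"
    then have \<mu>: "\<mu> > 0" using assms by (simp add: \<mu>_def)
    have "d \<alpha> \<beta> \<gamma> > 0" if neg: "\<beta>\<^sup>2 - \<alpha> * \<gamma> < 0" for \<alpha> \<beta> \<gamma>
    proof -
      have "d \<alpha> \<beta> \<gamma> = \<alpha>\<^sup>2 + \<kappa>\<^sup>2 * \<gamma>\<^sup>2 + (lam + \<mu>) * (\<alpha> * \<gamma> - \<beta>\<^sup>2) + (1 + \<kappa>\<^sup>2) * \<beta>\<^sup>2"
        unfolding d_def b4 lam\<mu>[symmetric] by algebra
      moreover have "(lam + \<mu>) * (\<alpha> * \<gamma> - \<beta>\<^sup>2) > 0"
        using lam \<mu> neg by (intro mult_pos_pos) auto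
      ultimately show ?thesis by (simp add: add_nonneg_pos add_pos_nonneg)
    qed
    then show "definite_regular (canonical_system \<kappa> lam)"
      unfolding reg by (metis less_irrefl)
  qed
qed

lemma sigma_gt_tau_iff:
  fixes \<kappa> lam :: real
  assumes "0 < \<kappa>" "0 < lam"
  shows "(\<kappa> - lam) / (\<kappa> + lam) > (1 - \<kappa>) / (1 + \<kappa>) \<longleftrightarrow> lam < \<kappa>\<^sup>2"
  using assms by (simp add: field_simps power2_eq_square)

section \<open>Strongly elliptic systems as Euler--Lagrange systems\<close>

theorem theorem1:
  fixes A B C :: "real^2^2" and \<tau> :: real and \<sigma> :: ereal and D :: "complex set"
  assumes "jordan_domain D"
    and "elliptic (A, B, C)"
    and "\<not> reducible (A, B, C)"
    and "canonical_parameters (A, B, C) \<tau> \<sigma>"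
  shows "(\<exists>(E :: real^4^4) (P :: real^2^2).
            transpose E = E \<and> nonneg_definite E \<and> det P \<noteq> 0 \<and>
            is_euler_lagrange_system D E (P ** A, P ** B, P ** C)) \<longleftrightarrow>
         strongly_elliptic (A, B, C) \<and> \<sigma> > ereal \<tau>"
proof -
  obtain \<kappa> lam where range: "\<kappa> \<in> {0<..1}" "lam \<in> {-\<kappa>..\<kappa>} - {0, \<kappa>\<^sup>2}"
    and reduces: "reduces_to (A, B, C) (canonical_system \<kappa> lam)"
    and \<tau>: "\<tau> = (1 - \<kappa>) / (1 + \<kappa>)"
    and \<sigma>: "\<sigma> = (if lam = -\<kappa> then \<infinity> else ereal ((\<kappa> - lam) / (\<kappa> + lam)))"
    using assms(4) unfolding canonical_parameters_def by blast
  have "variational (A, B, C) \<longleftrightarrow> variational (canonical_system \<kappa> lam)"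
    by (rule reduces_to_invariant[OF reduces variational_step])
  moreover have "variational (canonical_system \<kappa> lam) \<longleftrightarrow> 0 < lam \<and> lam < \<kappa>\<^sup>2"
    using variational_canonical_imp[OF range] variational_canonical[of \<kappa> lam] range(1) by auto
  ultimately have energy: "variational (A, B, C) \<longleftrightarrow> 0 < lam \<and> lam < \<kappa>\<^sup>2" by simp
  have "definite_regular (A, B, C) \<longleftrightarrow> definite_regular (canonical_system \<kappa> lam)"
    by (rule reduces_to_invariant[OF reduces definite_regular_step])
  moreover have "definite_regular (canonical_system \<kappa> lam) \<longleftrightarrow> 0 < lam"
    using definite_regular_canonical[of \<kappa> lam] range by auto
  ultimately have strong: "strongly_elliptic (A, B, C) \<longleftrightarrow> 0 < lam"
    using assms(2) by (simp only: strongly_elliptic.simps definite_regular.simps simp_thms)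
  have parameters: "\<sigma> > ereal \<tau> \<longleftrightarrow> lam < \<kappa>\<^sup>2" if "0 < lam"
    using that range sigma_gt_tau_iff[of \<kappa> lam] by (auto simp: \<sigma> \<tau>)
  have "variational (A, B, C) \<longleftrightarrow> strongly_elliptic (A, B, C) \<and> \<sigma> > ereal \<tau>"
    using energy strong parameters by metis
  then show ?thesis
    unfolding ex_energy_iff_variational[OF jordan_domain_open_nonempty[OF assms(1)], symmetric]
      combine.simps .
qed

end
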